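(* Let $0<\mu<L$, let $f:\mathbb{R}^n\to\mathbb{R}$ be $L$-smooth and $\mu$-strongly convex, let $g:\mathbb{R}^n\to(-\infty,+\infty]$ be proper, closed and convex, and let $\varphi=f+g$. For $t>0$ and $x\in\mathbb{R}^n$ let $x^+=\mathbf{prox}_{tg}(x-t\nabla f(x))=x-t\,\mathcal{G}_t(x)$. Then for every $x\in\mathbb{R}^n$ and every $0<t\le\frac1L$, $$\varphi(x)\ge \varphi(x^+)+\frac{t}{2}\|\mathcal{G}_t(x)\|^2+\frac{t}{2(1-\mu t)}\|\mathcal{G}_t(x^+)\|^2 .$$ In particular: (i) if $f:\mathbb{R}^n\to\mathbb{R}$ is convex and $L$-smooth ($L>0$) and $g$ is proper, closed and convex, then for every $x\in\mathbb{R}^n$ and every $0<t\le\frac1L$, $$\varphi(x)\ge \varphi(x^+)+\frac{t}{2}\|\mathcal{G}_t(x)\|^2+\frac{t}{2}\|\mathcal{G}_t(x^+)\|^2 ;$$ (ii) if $f:\mathbb{R}^n\to\mathbb{R}$ is convex and $L$-smooth ($L>0$) and $g\equiv 0$ (so that $x^+=x-t\nabla f(x)$), then for every $x\in\mathbb{R}^n$ and every $0<t\le\frac1L$, $$f(x)\ge f(x^+)+\frac{t}{2}\|\nabla f(x)\|^2+\frac{t}{2}\|\nabla f(x^+)\|^2 .$$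
   Context: $\mathbb{R}^n$ is Euclidean space with inner product $\langle\cdot,\cdot\rangle$ and induced norm $\|\cdot\|$. A differentiable function $f:\mathbb{R}^n\to\mathbb{R}$ is $L$-smooth if $\|\nabla f(x)-\nabla f(y)\|\le L\|x-y\|$ for all $x,y\in\mathbb{R}^n$; it is $\mu$-strongly convex if $x\mapsto f(x)-\frac{\mu}{2}\|x\|^2$ is convex on $\mathbb{R}^n$. For $t>0$ and $g$ proper closed convex, $\mathbf{prox}_{tg}(x):=\arg\min_{u\in\mathbb{R}^n}\{t g(u)+\frac12\|u-x\|^2\}$. The proximal gradient is $\mathcal{G}_t(x):=t^{-1}\left(x-\mathbf{prox}_{tg}(x-t\nabla f(x))\right)$. *)

theory Defs
  imports "HOL-Analysis.Analysis"
begin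

definition gradient :: "('a::real_inner \<Rightarrow> real) \<Rightarrow> 'a \<Rightarrow> 'a" where
  "gradient f x = (THE v. GDERIV f x :> v)"

definition L_smooth :: "real \<Rightarrow> ('a::real_inner \<Rightarrow> real) \<Rightarrow> bool" where
  "L_smooth L f \<longleftrightarrow>
     (\<forall>x. f differentiable (at x)) \<and>
     (\<forall>x y. norm (gradient f x - gradient f y) \<le> L * norm (x - y))"

definition strongly_convex :: "real \<Rightarrow> ('a::real_inner \<Rightarrow> real) \<Rightarrow> bool" where
  "strongly_convex \<mu> f \<longleftrightarrow> convex_on UNIV (\<lambda>x. f x - \<mu> / 2 * (norm x)\<^sup>2)"

text \<open>
  Functions into \<open>(-\<infinity>, +\<infinity>]\<close> are modelled as \<^typ>\<open>ereal\<close>-valued functions; that the value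
  \<open>-\<infinity>\<close> is not taken is part of properness. The library's \<^const>\<open>epigraph\<close> is for
  real-valued functions only. The epigraph consists of pairs with a real second component,
  so that its convexity and closedness are the usual convexity and lower semicontinuity of \<open>g\<close>.
\<close>

definition ereal_epigraph :: "('a \<Rightarrow> ereal) \<Rightarrow> ('a \<times> real) set" where
  "ereal_epigraph g = {(x, r). g x \<le> ereal r}"

definition proper_fun :: "('a \<Rightarrow> ereal) \<Rightarrow> bool" where
  "proper_fun g \<longleftrightarrow> (\<forall>x. g x \<noteq> -\<infinity>) \<and> (\<exists>x. g x \<noteq> \<infinity>)"

definition closed_fun :: "('a::topological_space \<Rightarrow> ereal) \<Rightarrow> bool" where
  "closed_fun g \<longleftrightarrow> closed (ereal_epigraph g)"

definition convex_fun :: "('a::real_vector \<Rightarrow> ereal) \<Rightarrow> bool" where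
  "convex_fun g \<longleftrightarrow> convex (ereal_epigraph g)"

text \<open>
  \<open>prox t g\<close> is the proximal operator of the function \<open>t g\<close>. For \<open>t > 0\<close> and \<open>g\<close> proper, closed
  and convex the minimiser exists and is unique, so the choice made by \<^const>\<open>arg_min\<close> is
  immaterial.
\<close>

definition prox :: "real \<Rightarrow> ('a::euclidean_space \<Rightarrow> ereal) \<Rightarrow> 'a \<Rightarrow> 'a" where
  "prox t g x = (ARG_MIN (\<lambda>u. ereal t * g u + ereal (1 / 2 * (norm (u - x))\<^sup>2)) u. True)"

definition prox_grad_step ::
    "('a::euclidean_space \<Rightarrow> real) \<Rightarrow> ('a \<Rightarrow> ereal) \<Rightarrow> real \<Rightarrow> 'a \<Rightarrow> 'a" where
  "prox_grad_step f g t x = prox t g (x - t *\<^sub>R gradient f x)"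

definition prox_gradient ::
    "('a::euclidean_space \<Rightarrow> real) \<Rightarrow> ('a \<Rightarrow> ereal) \<Rightarrow> real \<Rightarrow> 'a \<Rightarrow> 'a" where
  "prox_gradient f g t x = inverse t *\<^sub>R (x - prox t g (x - t *\<^sub>R gradient f x))"

lemma prox_grad_step_eq:
  "t > 0 \<Longrightarrow> prox_grad_step f g t x = x - t *\<^sub>R prox_gradient f g t x"
  by (simp add: prox_grad_step_def prox_gradient_def)

definition composite :: "('a \<Rightarrow> real) \<Rightarrow> ('a \<Rightarrow> ereal) \<Rightarrow> 'a \<Rightarrow> ereal" where
  "composite f g x = ereal (f x) + g x"

end

theory Submission
  imports Defs
begin

text \<open>
  Write \<open>G\<close> for the proximal gradient at \<open>x\<close>, \<open>y = x - t G\<close> for the step and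
  \<open>d = \<nabla>f(x) - \<nabla>f(y)\<close>.

  The optimality condition of the proximal operator says that \<open>G - \<nabla>f(x)\<close> is a subgradient of \<open>g\<close>
  at \<open>y\<close> (\<open>prox_variational_inequality\<close>), which bounds \<open>g(x)\<close> below. For \<open>f(x)\<close> the gradient
  inequality at \<open>y\<close> is too weak: smoothness and strong convexity together improve it by
  \<open>\<mu>/2 \<parallel>x - y\<parallel>\<^sup>2\<close> plus a multiple of \<open>\<parallel>d - \<mu> (x - y)\<parallel>\<^sup>2\<close> (\<open>smooth_strongly_convex_interpolation\<close>, with \<open>1/t \<ge> L\<close> as
  smoothness constant). After both bounds are added, everything beyond \<open>\<phi>(y) + t/2 \<parallel>G\<parallel>\<^sup>2\<close> is
  exactly the complete square \<open>t / (2 (1 - \<mu> t)) \<parallel>G - d\<parallel>\<^sup>2\<close>.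

  The vector \<open>G - d = (G - \<nabla>f(x)) + \<nabla>f(y)\<close> is a subgradient of \<open>\<phi> = f + g\<close> at \<open>y\<close>, and the
  proximal gradient at a point is never longer than a subgradient of \<open>\<phi>\<close> there, by monotonicity of
  \<open>\<partial>g\<close> (\<open>norm_prox_gradient_step_le\<close>). This replaces \<open>\<parallel>G - d\<parallel>\<close> by the norm of the proximal
  gradient at \<open>y\<close>. The convex case is \<open>\<mu> = 0\<close>, and for \<open>g = 0\<close> the proximal operator is the identity.

  All of this needs the proximal operator to be a genuine minimiser. It is one because a
  proper closed convex function has an affine minorant, so that the quadratic term makes the
  sublevel sets of the proximal objective compact.
\<close>

section \<open>Curvature bounds for smooth and strongly convex functions\<close>

text \<open>
  In a Euclidean space every derivative is the inner product with some vector, and that vector is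
  unique, so the definite description in the definition of the gradient is met.
\<close>

lemma gradient_GDERIV:
  fixes f :: "'a::euclidean_space \<Rightarrow> real"
  assumes "f differentiable (at x)"
  shows "GDERIV f x :> gradient f x"
proof -
  obtain D where D: "(f has_derivative D) (at x)"
    using assms unfolding differentiable_def by blast
  define v where "v = (\<Sum>b\<in>Basis. D b *\<^sub>R b)"
  have lin: "linear D"
    using D has_derivative_linear by blast
  have "D h = h \<bullet> v" for h
  proof -
    have "D h = D (\<Sum>b\<in>Basis. (h \<bullet> b) *\<^sub>R b)"
      by (simp add: euclidean_representation)
    also have "\<dots> = (\<Sum>b\<in>Basis. (h \<bullet> b) * D b)"
      using lin by (simp add: linear_sum linear_scale)
    also have "\<dots> = h \<bullet> v"
      by (simp add: v_def inner_sum_right mult.commute)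
    finally show ?thesis .
  qed
  then have "GDERIV f x :> v"
    using D unfolding gderiv_def by presburger
  moreover have "w = v" if "GDERIV f x :> w" for w
  proof -
    have "(\<lambda>h. h \<bullet> w) = (\<lambda>h. h \<bullet> v)"
      using that \<open>GDERIV f x :> v\<close> unfolding gderiv_def by (rule has_derivative_unique)
    then show ?thesis
      by (metis vector_eq_ldot)
  qed
  ultimately show ?thesis
    unfolding gradient_def by (rule theI)
qed

lemma has_real_derivative_along_line:
  fixes f :: "'a::euclidean_space \<Rightarrow> real"
  assumes "\<And>x. f differentiable (at x)"
  shows "((\<lambda>s. f (x + s *\<^sub>R w)) has_real_derivative (w \<bullet> gradient f (x + s *\<^sub>R w))) (at s within S)"
proof -
  have "(f has_derivative (\<lambda>h. h \<bullet> gradient f (x + s *\<^sub>R w))) (at (x + s *\<^sub>R w))"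
    using gradient_GDERIV[OF assms] unfolding gderiv_def by blast
  moreover have "((\<lambda>s. x + s *\<^sub>R w) has_derivative (\<lambda>h. h *\<^sub>R w)) (at s within S)"
    by (auto intro!: derivative_eq_intros)
  ultimately have "((\<lambda>s. f (x + s *\<^sub>R w)) has_derivative
      (\<lambda>h. (h *\<^sub>R w) \<bullet> gradient f (x + s *\<^sub>R w))) (at s within S)"
    by (rule has_derivative_compose[rotated])
  then show ?thesis
    by (simp add: has_field_derivative_def mult.commute[of _ "w \<bullet> _"])
qed

text \<open>
  The upper bound and the restriction of \<open>f\<close> to the segment agree to first order at \<open>x\<close>; by the
  Lipschitz condition their difference has a derivative of constant sign along the segment.
\<close>

lemma descent_lemma:
  fixes f :: "'a::euclidean_space \<Rightarrow> real"
  assumes "L_smooth L f"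
  shows "f (x + w) \<le> f x + gradient f x \<bullet> w + L / 2 * (norm w)\<^sup>2"
proof -
  have diff: "\<And>x. f differentiable (at x)"
    and lip: "\<And>x y. norm (gradient f x - gradient f y) \<le> L * norm (x - y)"
    using assms unfolding L_smooth_def by auto
  define q where "q s = f (x + s *\<^sub>R w) - s * (gradient f x \<bullet> w) - L / 2 * s\<^sup>2 * (norm w)\<^sup>2" for s
  define q' where "q' s = w \<bullet> gradient f (x + s *\<^sub>R w) - gradient f x \<bullet> w - L * s * (norm w)\<^sup>2" for s
  have "q 1 \<le> q 0"
  proof (rule DERIV_nonpos_imp_nonincreasing[of 0 1 q])
    fix s :: real assume "0 \<le> s" "s \<le> 1"
    have "DERIV q s :> q' s"
      unfolding q_def q'_def
      by (rule derivative_eq_intros has_real_derivative_along_line diff refl | simp)+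
    moreover have "q' s \<le> 0"
    proof -
      have "w \<bullet> gradient f (x + s *\<^sub>R w) - gradient f x \<bullet> w
          = w \<bullet> (gradient f (x + s *\<^sub>R w) - gradient f x)"
        by (simp add: inner_diff_right inner_commute)
      also have "\<dots> \<le> norm w * norm (gradient f (x + s *\<^sub>R w) - gradient f x)"
        by (rule norm_cauchy_schwarz)
      also have "\<dots> \<le> norm w * (L * norm (s *\<^sub>R w))"
        using lip[of "x + s *\<^sub>R w" x] by (intro mult_left_mono) auto
      also have "\<dots> = L * s * (norm w)\<^sup>2"
        using \<open>0 \<le> s\<close> by (simp add: power2_eq_square)
      finally show ?thesis unfolding q'_def by simp
    qed
    ultimately show "\<exists>y. DERIV q s :> y \<and> y \<le> 0" by blast
  qed simp
  then show ?thesis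
    unfolding q_def by simp
qed

text \<open>
  The tangent inequality for the convex function \<open>f - \<mu>/2 \<parallel>\<cdot>\<parallel>\<^sup>2\<close> along a line; completing the square
  turns the subtracted quadratic into one centred at the point of tangency.
\<close>

lemma strongly_convex_above_tangent:
  fixes f :: "'a::euclidean_space \<Rightarrow> real"
  assumes diff: "\<And>x. f differentiable (at x)" and conv: "strongly_convex \<mu> f"
  shows "f (y + w) \<ge> f y + gradient f y \<bullet> w + \<mu> / 2 * (norm w)\<^sup>2"
proof -
  define q where "q s = f (y + s *\<^sub>R w) - \<mu> / 2 * (norm (y + s *\<^sub>R w))\<^sup>2" for s
  have "convex_on UNIV q"
  proof (rule convex_onI)
    fix t a b :: real assume "0 < t" "t < 1"
    have "y + ((1 - t) *\<^sub>R a + t *\<^sub>R b) *\<^sub>R w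
        = (1 - t) *\<^sub>R (y + a *\<^sub>R w) + t *\<^sub>R (y + b *\<^sub>R w)"
      by (simp add: algebra_simps)
    then show "q ((1 - t) *\<^sub>R a + t *\<^sub>R b) \<le> (1 - t) * q a + t * q b"
      using convex_onD[OF conv[unfolded strongly_convex_def], of t "y + a *\<^sub>R w" "y + b *\<^sub>R w"]
        \<open>0 < t\<close> \<open>t < 1\<close>
      unfolding q_def by simp
  qed simp
  moreover have "(q has_real_derivative (w \<bullet> gradient f y - \<mu> * (y \<bullet> w))) (at 0 within UNIV)"
  proof -
    have "q = (\<lambda>s. f (y + s *\<^sub>R w)
        - \<mu> / 2 * (y \<bullet> y + 2 * s * (y \<bullet> w) + s\<^sup>2 * (w \<bullet> w)))"
      unfolding q_def power2_norm_eq_inner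
      by (simp add: fun_eq_iff algebra_simps inner_commute power2_eq_square)
    moreover have "((\<lambda>s. f (y + s *\<^sub>R w)) has_real_derivative (w \<bullet> gradient f y)) (at 0)"
      using has_real_derivative_along_line[OF diff, of y w 0 UNIV] by simp
    ultimately show ?thesis
      by (auto intro!: derivative_eq_intros)
  qed
  ultimately have "q 1 - q 0 \<ge> (w \<bullet> gradient f y - \<mu> * (y \<bullet> w)) * (1 - 0)"
    by (intro convex_on_imp_above_tangent[where A = UNIV]) auto
  then show ?thesis
    unfolding q_def power2_norm_eq_inner by (simp add: algebra_simps inner_commute)
qed

text \<open>
  At any test point \<open>x + w\<close> the value of \<open>f\<close> lies below the quadratic of curvature \<open>1/t\<close> tangent
  at \<open>x\<close> and above the quadratic of curvature \<open>\<mu>\<close> tangent at \<open>y\<close>. Comparing the two bounds \<open>f(x)\<close>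
  from below for every \<open>w\<close>; the claim is the bound for the best \<open>w\<close>.
\<close>

lemma smooth_strongly_convex_interpolation:
  fixes f :: "'a::euclidean_space \<Rightarrow> real" and x y :: 'a
  assumes smooth: "L_smooth L f" and conv: "strongly_convex \<mu> f"
    and t: "0 < t" "t * L \<le> 1" "\<mu> * t < 1"
  defines "d \<equiv> gradient f x - gradient f y"
  shows "f x \<ge> f y + gradient f y \<bullet> (x - y) + \<mu> / 2 * (norm (x - y))\<^sup>2
      + t / (2 * (1 - \<mu> * t)) * (norm (d - \<mu> *\<^sub>R (x - y)))\<^sup>2"
proof -
  define e where "e = d - \<mu> *\<^sub>R (x - y)"
  define c where "c = t / (1 - \<mu> * t)"
  \<comment> \<open>The gap between the two quadratics is, as a function of \<open>w\<close>, an affine function with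
    slope \<open>e\<close> plus a quadratic with curvature \<open>1/t - \<mu> = 1/c\<close>; this is its minimiser.\<close>
  define w where "w = - (c *\<^sub>R e)"
  have diff: "\<And>x. f differentiable (at x)"
    using smooth unfolding L_smooth_def by auto
  have "L \<le> 1 / t"
    using t by (simp add: field_simps)
  then have "L / 2 * (norm w)\<^sup>2 \<le> 1 / (2 * t) * (norm w)\<^sup>2"
    by (intro mult_right_mono) auto
  then have up: "f (x + w) \<le> f x + gradient f x \<bullet> w + 1 / (2 * t) * (norm w)\<^sup>2"
    using descent_lemma[OF smooth, of x w] by linarith
  have low: "f (x + w) \<ge> f y + gradient f y \<bullet> (x - y + w) + \<mu> / 2 * (norm (x - y + w))\<^sup>2"
    using strongly_convex_above_tangent[OF diff conv, of y "x - y + w"]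
    by (simp add: algebra_simps)
  have "(norm (x - y + w))\<^sup>2 = (norm (x - y))\<^sup>2 + 2 * ((x - y) \<bullet> w) + (norm w)\<^sup>2"
    by (simp add: power2_norm_eq_inner inner_add_left inner_add_right inner_commute)
  then have "\<mu> / 2 * (norm (x - y + w))\<^sup>2
      = \<mu> / 2 * (norm (x - y))\<^sup>2 + \<mu> * ((x - y) \<bullet> w) + \<mu> / 2 * (norm w)\<^sup>2"
    by (simp only: distrib_left)
  moreover have "gradient f y \<bullet> (x - y + w) = gradient f y \<bullet> (x - y) + gradient f y \<bullet> w"
    by (simp add: inner_add_right)
  moreover have "e \<bullet> w = gradient f x \<bullet> w - gradient f y \<bullet> w - \<mu> * ((x - y) \<bullet> w)"
    by (simp add: e_def d_def inner_diff_left)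
  ultimately have "f x \<ge> f y + gradient f y \<bullet> (x - y) + \<mu> / 2 * (norm (x - y))\<^sup>2
      - (e \<bullet> w + (1 / (2 * t) - \<mu> / 2) * (norm w)\<^sup>2)"
    using up low unfolding left_diff_distrib by linarith
  moreover have "e \<bullet> w + (1 / (2 * t) - \<mu> / 2) * (norm w)\<^sup>2 = - (c / 2 * (norm e)\<^sup>2)"
  proof -
    have "1 / (2 * t) - \<mu> / 2 = 1 / (2 * c)"
      using t by (simp add: c_def field_simps)
    moreover have "c > 0"
      using t by (simp add: c_def)
    moreover have "e \<bullet> w + 1 / (2 * c) * (norm w)\<^sup>2 = - (c / 2 * (norm e)\<^sup>2)"
      using \<open>c > 0\<close> unfolding w_def power2_norm_eq_inner by (simp add: field_simps)
    ultimately show ?thesis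
      by simp
  qed
  moreover have "t / (2 * (1 - \<mu> * t)) = c / 2"
    by (simp only: c_def divide_divide_eq_left mult.commute)
  ultimately show ?thesis
    unfolding e_def[symmetric] by (simp only:)
qed

section \<open>The proximal operator\<close>

text \<open>
  Separate the epigraph from a point just below its boundary. The separating hyperplane cannot be
  vertical, since a point of the epigraph lies directly above the separated point, so it is the
  graph of an affine function below \<open>g\<close>.
\<close>

lemma proper_closed_convex_affine_minorant:
  fixes g :: "'a::euclidean_space \<Rightarrow> ereal"
  assumes "proper_fun g" "closed_fun g" "convex_fun g"
  obtains a b where "\<And>u r. g u \<le> ereal r \<Longrightarrow> r \<ge> a \<bullet> u + b"
proof -
  obtain x0 where "g x0 \<noteq> \<infinity>" "g x0 \<noteq> -\<infinity>"
    using assms(1) unfolding proper_fun_def by auto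
  then obtain r0 where r0: "g x0 = ereal r0"
    by (cases "g x0") auto
  have "(x0, r0 - 1) \<notin> ereal_epigraph g"
    using r0 by (simp add: ereal_epigraph_def)
  then obtain n c where n: "n \<bullet> (x0, r0 - 1) < c" "\<forall>p\<in>ereal_epigraph g. n \<bullet> p > c"
    using separating_hyperplane_closed_point[of "ereal_epigraph g" "(x0, r0 - 1)"] assms(2,3)
    unfolding convex_fun_def closed_fun_def by blast
  obtain n1 n2 where n12: "n = (n1, n2)"
    by (cases n)
  have above: "n1 \<bullet> u + n2 * r > c" if "g u \<le> ereal r" for u r
    using n(2) that by (force simp: n12 ereal_epigraph_def inner_Pair)
  have "n2 > 0"
    using above[of x0 r0] r0 n(1) by (simp add: n12 inner_Pair algebra_simps)
  have "r \<ge> (- (n1 /\<^sub>R n2)) \<bullet> u + c / n2" if "g u \<le> ereal r" for u r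
    using above[OF that] \<open>n2 > 0\<close> by (simp add: field_simps)
  then show thesis
    using that by blast
qed

text \<open>
  Minimising over the epigraph instead of the space makes the objective a continuous real-valued
  function on a closed set, so that attainment becomes an instance of compactness once the
  sublevel sets are shown to be bounded.
\<close>

lemma prox_objective_attains_min:
  fixes g :: "'a::euclidean_space \<Rightarrow> ereal"
  assumes g: "proper_fun g" "closed_fun g" "convex_fun g" and "t > 0"
  obtains p r where "g p \<le> ereal r"
    and "\<And>u s. g u \<le> ereal s \<Longrightarrow>
           t * r + 1 / 2 * (norm (p - z))\<^sup>2 \<le> t * s + 1 / 2 * (norm (u - z))\<^sup>2"
proof -
  define \<psi> where "\<psi> q = t * snd q + 1 / 2 * (norm (fst q - z))\<^sup>2" for q :: "'a \<times> real"
  obtain x0 where "g x0 \<noteq> \<infinity>" "g x0 \<noteq> -\<infinity>"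
    using g(1) unfolding proper_fun_def by auto
  then obtain r0 where r0: "g x0 = ereal r0"
    by (cases "g x0") auto
  define S where "S = ereal_epigraph g \<inter> {q. \<psi> q \<le> \<psi> (x0, r0)}"
  have cont: "continuous_on A \<psi>" for A
    unfolding \<psi>_def by (intro continuous_intros)
  have "closed S"
    unfolding S_def using g(2) cont[of UNIV]
    by (auto simp: closed_fun_def intro!: closed_Int closed_Collect_le continuous_on_const)
  moreover have "bounded S"
  proof -
    obtain a b where ab: "\<And>u r. g u \<le> ereal r \<Longrightarrow> r \<ge> a \<bullet> u + b"
      using proper_closed_convex_affine_minorant[OF g] by blast
    \<comment> \<open>Replacing \<open>g\<close> by its affine minorant turns the objective into a quadratic centred at \<open>v\<close>;
      \<open>K\<close> is what remains of the bound \<open>C\<close> after completing that square.\<close>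
    define C where "C = \<psi> (x0, r0)"
    define v where "v = z - t *\<^sub>R a"
    define K where "K = 2 * C - 2 * t * b - 2 * t * (a \<bullet> z) + t\<^sup>2 * (a \<bullet> a)"
    have sub: "(u, r) \<in> cball v (sqrt K) \<times> {- (norm a * (norm v + sqrt K)) + b .. C / t}"
      if "(u, r) \<in> S" for u r
    proof -
      have le: "t * r + 1 / 2 * (norm (u - z))\<^sup>2 \<le> C" and minor: "r \<ge> a \<bullet> u + b"
        using that ab unfolding S_def ereal_epigraph_def \<psi>_def C_def by auto
      have "(norm (u - v))\<^sup>2 = (norm (u - z))\<^sup>2 + 2 * t * (a \<bullet> u) - 2 * t * (a \<bullet> z) + t\<^sup>2 * (a \<bullet> a)"
        unfolding v_def power2_norm_eq_inner
        by (simp add: algebra_simps inner_commute power2_eq_square)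
      moreover have "t * r \<ge> t * (a \<bullet> u) + t * b"
        using mult_left_mono[OF minor, of t] \<open>t > 0\<close> by (simp add: algebra_simps)
      ultimately have "(norm (u - v))\<^sup>2 \<le> K"
        using le unfolding K_def by linarith
      then have near: "norm (u - v) \<le> sqrt K"
        by (rule real_le_rsqrt)
      have "norm u \<le> norm v + norm (u - v)"
        by (metis norm_triangle_sub)
      then have "norm u \<le> norm v + sqrt K"
        using near by linarith
      then have "norm a * norm u \<le> norm a * (norm v + sqrt K)"
        by (intro mult_left_mono) auto
      moreover have "- (norm a * norm u) \<le> a \<bullet> u"
        using Cauchy_Schwarz_ineq2[of a u] by linarith
      moreover have "t * r \<le> C"
        using le zero_le_power2[of "norm (u - z)"] by linarith
      ultimately show ?thesis
        using minor near \<open>t > 0\<close> by (auto simp: dist_norm norm_minus_commute field_simps)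
    qed
    have "bounded (cball v (sqrt K) \<times> {- (norm a * (norm v + sqrt K)) + b .. C / t})"
      by (intro bounded_Times bounded_cball bounded_closed_interval)
    then show ?thesis
      by (rule bounded_subset) (use sub in auto)
  qed
  moreover have "(x0, r0) \<in> S"
    using r0 by (simp add: S_def ereal_epigraph_def)
  ultimately obtain q where q: "q \<in> S" "\<And>q'. q' \<in> S \<Longrightarrow> \<psi> q \<le> \<psi> q'"
    using continuous_attains_inf[of S \<psi>] cont compact_eq_bounded_closed by (metis empty_iff)
  have "\<psi> q \<le> \<psi> (u, s)" if "g u \<le> ereal s" for u s
    using that q unfolding S_def ereal_epigraph_def
    by (cases "\<psi> (u, s) \<le> \<psi> (x0, r0)") auto
  moreover have "g (fst q) \<le> ereal (snd q)"
    using q(1) by (auto simp: S_def ereal_epigraph_def)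
  ultimately show thesis
    using that[of "fst q" "snd q"] by (simp add: \<psi>_def)
qed

lemma prox_minimises:
  fixes g :: "'a::euclidean_space \<Rightarrow> ereal"
  assumes g: "proper_fun g" "closed_fun g" "convex_fun g" and "t > 0"
  obtains r where "g (prox t g z) = ereal r"
    and "\<And>u s. g u \<le> ereal s \<Longrightarrow>
           t * r + 1 / 2 * (norm (prox t g z - z))\<^sup>2 \<le> t * s + 1 / 2 * (norm (u - z))\<^sup>2"
proof -
  define F where "F u = ereal t * g u + ereal (1 / 2 * (norm (u - z))\<^sup>2)" for u
  obtain p r where p: "g p \<le> ereal r"
    and min: "\<And>u s. g u \<le> ereal s \<Longrightarrow>
           t * r + 1 / 2 * (norm (p - z))\<^sup>2 \<le> t * s + 1 / 2 * (norm (u - z))\<^sup>2"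
    using prox_objective_attains_min[OF assms, where z = z] by blast
  have not_minf: "g u \<noteq> -\<infinity>" for u
    using g(1) by (simp add: proper_fun_def)
  have Fp: "F p \<le> ereal (t * r + 1 / 2 * (norm (p - z))\<^sup>2)"
    using p not_minf[of p] \<open>t > 0\<close> unfolding F_def by (cases "g p") auto
  have "ereal (t * r + 1 / 2 * (norm (p - z))\<^sup>2) \<le> F u" for u
    using min[of u] not_minf[of u] \<open>t > 0\<close> unfolding F_def by (cases "g u") auto
  with Fp have "is_arg_min F (\<lambda>_. True) p"
    by (auto simp: is_arg_min_def not_less intro: order_trans)
  then have "is_arg_min F (\<lambda>_. True) (arg_min F (\<lambda>_. True))"
    unfolding arg_min_def by (rule someI)
  moreover have "arg_min F (\<lambda>_. True) = prox t g z"
    by (simp add: prox_def F_def[abs_def])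
  ultimately have "F (prox t g z) \<le> F u" for u
    by (auto simp: is_arg_min_def not_less)
  note le = this
  have "F (prox t g z) \<noteq> \<infinity>"
    using order_trans[OF le Fp] by auto
  then obtain r' where r': "g (prox t g z) = ereal r'"
    using not_minf[of "prox t g z"] \<open>t > 0\<close> unfolding F_def by (cases "g (prox t g z)") auto
  have "t * r' + 1 / 2 * (norm (prox t g z - z))\<^sup>2 \<le> t * s + 1 / 2 * (norm (u - z))\<^sup>2"
    if "g u \<le> ereal s" for u s
  proof -
    have "F (prox t g z) \<le> ereal (t * s + 1 / 2 * (norm (u - z))\<^sup>2)"
      using order_trans[OF le[of u]] that not_minf[of u] \<open>t > 0\<close>
      unfolding F_def[of u] by (cases "g u") auto
    then show ?thesis
      by (simp add: F_def r')
  qed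
  with r' show thesis
    using that by blast
qed

text \<open>
  This says that \<open>(z - p) / t\<close> is a subgradient of \<open>g\<close> at \<open>p = prox t g z\<close>. The minimum is compared
  with the objective at points of the segment from \<open>p\<close> to \<open>u\<close>: convexity controls \<open>g\<close> there, and
  the quadratic term contributes only to second order in the distance from \<open>p\<close>.
  The variable \<open>s\<close> ranges over real upper bounds of \<open>g u\<close>, which keeps the inequality in the
  reals and restricts \<open>u\<close> to the domain of \<open>g\<close>.
\<close>

lemma prox_variational_inequality:
  fixes g :: "'a::euclidean_space \<Rightarrow> ereal"
  assumes g: "proper_fun g" "closed_fun g" "convex_fun g" and "t > 0"
  obtains r where "g (prox t g z) = ereal r"
    and "\<And>u s. g u \<le> ereal s \<Longrightarrow>
           t * r + (z - prox t g z) \<bullet> (u - prox t g z) \<le> t * s"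
proof -
  define p where "p = prox t g z"
  obtain r where r: "g p = ereal r"
    and min: "\<And>u s. g u \<le> ereal s \<Longrightarrow>
           t * r + 1 / 2 * (norm (p - z))\<^sup>2 \<le> t * s + 1 / 2 * (norm (u - z))\<^sup>2"
    using prox_minimises[OF assms, of z] unfolding p_def by metis
  have "t * r + (z - p) \<bullet> (u - p) \<le> t * s" if us: "g u \<le> ereal s" for u s
  proof -
    define A where "A = t * s - t * r - (z - p) \<bullet> (u - p)"
    define B where "B = 1 / 2 * (norm (u - p))\<^sup>2"
    have pos: "0 \<le> A + \<theta> * B" if \<theta>: "0 < \<theta>" "\<theta> \<le> 1" for \<theta>
    proof -
      have "(1 - \<theta>) *\<^sub>R (p, r) + \<theta> *\<^sub>R (u, s) \<in> ereal_epigraph g"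
        using g(3) us r \<theta> unfolding convex_fun_def convex_alt
        by (auto simp: ereal_epigraph_def)
      then have "g ((1 - \<theta>) *\<^sub>R p + \<theta> *\<^sub>R u) \<le> ereal ((1 - \<theta>) * r + \<theta> * s)"
        by (simp add: ereal_epigraph_def)
      from min[OF this]
      have "t * r + 1 / 2 * (norm (p - z))\<^sup>2 \<le> t * ((1 - \<theta>) * r + \<theta> * s)
          + 1 / 2 * (norm ((1 - \<theta>) *\<^sub>R p + \<theta> *\<^sub>R u - z))\<^sup>2" .
      moreover have "(1 - \<theta>) *\<^sub>R p + \<theta> *\<^sub>R u - z = (p - z) + \<theta> *\<^sub>R (u - p)"
        by (simp add: algebra_simps)
      moreover have "(norm ((p - z) + \<theta> *\<^sub>R (u - p)))\<^sup>2
          = (norm (p - z))\<^sup>2 - 2 * \<theta> * ((z - p) \<bullet> (u - p)) + \<theta>\<^sup>2 * (norm (u - p))\<^sup>2"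
        unfolding power2_norm_eq_inner
        by (simp add: algebra_simps inner_commute power2_eq_square)
      ultimately have "0 \<le> \<theta> * (A + \<theta> * B)"
        by (simp add: A_def B_def algebra_simps power2_eq_square)
      then show ?thesis
        using \<theta> by (simp add: zero_le_mult_iff)
    qed
    have "((\<lambda>\<theta>. A + \<theta> * B) \<longlongrightarrow> A + 0 * B) (at_right 0)"
      by (intro tendsto_intros)
    moreover have "\<forall>\<^sub>F \<theta> in at_right (0::real). 0 \<le> A + \<theta> * B"
      unfolding eventually_at_right_field using pos by (intro exI[of _ 1]) auto
    ultimately have "0 \<le> A + 0 * B"
      by (intro tendsto_lowerbound) auto
    then show ?thesis by (simp add: A_def)
  qed
  with r show thesis
    using that unfolding p_def by blast
qed

section \<open>Decrease of the composite objective\<close>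

lemma prox_gradient_shift:
  assumes "t > 0"
  shows "x - prox_grad_step f g t x = t *\<^sub>R prox_gradient f g t x"
  using prox_grad_step_eq[OF assms, of f g x] by simp

text \<open>
  Add the variational inequalities of two consecutive steps, each tested at the end point of the other
  (monotonicity of the subdifferential of \<open>g\<close>). With \<open>v\<close> the vector on the right and \<open>G'\<close> the
  proximal gradient at \<open>y\<close> this gives \<open>\<parallel>G'\<parallel>\<^sup>2 \<le> \<langle>v, G'\<rangle>\<close>, and Cauchy--Schwarz finishes.
\<close>

lemma norm_prox_gradient_step_le:
  fixes f :: "'a::euclidean_space \<Rightarrow> real" and g :: "'a \<Rightarrow> ereal" and x :: 'a
  assumes g: "proper_fun g" "closed_fun g" "convex_fun g" and t: "t > 0"
  defines "y \<equiv> prox_grad_step f g t x"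
  shows "norm (prox_gradient f g t y)
      \<le> norm (prox_gradient f g t x - (gradient f x - gradient f y))"
proof -
  define y' where "y' = prox_grad_step f g t y"
  define G where "G = prox_gradient f g t x"
  define G' where "G' = prox_gradient f g t y"
  have xy: "x - y = t *\<^sub>R G" and yy': "y - y' = t *\<^sub>R G'"
    using prox_gradient_shift[OF t] by (auto simp: y_def y'_def G_def G'_def)
  obtain r where r: "g y = ereal r"
    and var: "\<And>u s. g u \<le> ereal s \<Longrightarrow> t * r + (x - t *\<^sub>R gradient f x - y) \<bullet> (u - y) \<le> t * s"
    using prox_variational_inequality[OF g t, of "x - t *\<^sub>R gradient f x"]
    unfolding y_def prox_grad_step_def by metis
  obtain r' where r': "g y' = ereal r'"
    and var': "\<And>u s. g u \<le> ereal s \<Longrightarrow> t * r' + (y - t *\<^sub>R gradient f y - y') \<bullet> (u - y') \<le> t * s"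
    using prox_variational_inequality[OF g t, of "y - t *\<^sub>R gradient f y"]
    unfolding y'_def prox_grad_step_def[of f g t y] by metis
  define v where "v = G - (gradient f x - gradient f y)"
  have "x - t *\<^sub>R gradient f x - y = t *\<^sub>R (G - gradient f x)"
    using xy by (simp add: algebra_simps)
  moreover have "y - t *\<^sub>R gradient f y - y' = t *\<^sub>R (G' - gradient f y)"
    using yy' by (simp add: algebra_simps)
  moreover have "y' - y = - (t *\<^sub>R G')"
    using yy' by (simp add: algebra_simps)
  ultimately have "t *\<^sub>R (G - gradient f x) \<bullet> (- (t *\<^sub>R G'))
      + t *\<^sub>R (G' - gradient f y) \<bullet> (t *\<^sub>R G') \<le> 0"
    using var[of y' r'] var'[of y r] r r' yy' by simp
  moreover have "t *\<^sub>R (G - gradient f x) \<bullet> (- (t *\<^sub>R G'))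
      + t *\<^sub>R (G' - gradient f y) \<bullet> (t *\<^sub>R G') = (t * t) * (G' \<bullet> G' - v \<bullet> G')"
    by (simp add: v_def algebra_simps)
  ultimately have "(t * t) * (G' \<bullet> G' - v \<bullet> G') \<le> 0"
    by simp
  then have "G' \<bullet> G' \<le> v \<bullet> G'"
    using t by (simp add: mult_le_0_iff)
  also have "\<dots> \<le> norm v * norm G'"
    by (rule norm_cauchy_schwarz)
  finally have "norm G' * norm G' \<le> norm v * norm G'"
    by (metis power2_norm_eq_inner power2_eq_square)
  then have "norm G' \<le> norm v"
    by (cases "G' = 0") auto
  then show ?thesis
    by (simp add: G_def G'_def v_def)
qed

text \<open>
  This is the common form of the strongly convex and the merely convex case (\<open>\<mu> = 0\<close>). The hypothesis
  \<open>\<mu> t < 1\<close> makes the weight of the last term positive, which is what allows the square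
  \<open>\<parallel>G - d\<parallel>\<^sup>2\<close> to be replaced by a smaller one.
\<close>

lemma prox_grad_step_decrease:
  fixes f :: "'a::euclidean_space \<Rightarrow> real" and g :: "'a \<Rightarrow> ereal" and x :: 'a
  assumes smooth: "L_smooth L f" and conv: "strongly_convex \<mu> f"
    and g: "proper_fun g" "closed_fun g" "convex_fun g"
    and t: "0 < t" "t * L \<le> 1" "\<mu> * t < 1"
  defines "y \<equiv> prox_grad_step f g t x"
  shows "composite f g x \<ge> composite f g y
      + ereal (t / 2 * (norm (prox_gradient f g t x))\<^sup>2)
      + ereal (t / (2 * (1 - \<mu> * t)) * (norm (prox_gradient f g t y))\<^sup>2)"
proof (cases "g x = \<infinity>")
  case True
  then show ?thesis
    by (simp add: composite_def)
next
  case False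
  then obtain s where s: "g x = ereal s"
    using g(1) unfolding proper_fun_def by (cases "g x") auto
  define G where "G = prox_gradient f g t x"
  define d where "d = gradient f x - gradient f y"
  define c where "c = t / (2 * (1 - \<mu> * t))"
  have "c > 0"
    using t by (simp add: c_def)
  have xy: "x - y = t *\<^sub>R G"
    using prox_gradient_shift[OF t(1)] by (simp add: y_def G_def)
  obtain r where r: "g y = ereal r"
    and var: "\<And>u s. g u \<le> ereal s \<Longrightarrow> t * r + (x - t *\<^sub>R gradient f x - y) \<bullet> (u - y) \<le> t * s"
    using prox_variational_inequality[OF g t(1), of "x - t *\<^sub>R gradient f x"]
    unfolding y_def prox_grad_step_def by metis
  have "x - t *\<^sub>R gradient f x - y = t *\<^sub>R (G - gradient f x)"
    using xy by (simp add: algebra_simps)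
  then have "t * s \<ge> t * r + (t *\<^sub>R (G - gradient f x)) \<bullet> (t *\<^sub>R G)"
    using var[of x s] s xy by simp
  then have "t * s \<ge> t * (r + t * ((G - gradient f x) \<bullet> G))"
    by (simp add: algebra_simps)
  then have g_ineq: "s \<ge> r + t * ((G - gradient f x) \<bullet> G)"
    using t(1) by simp
  have f_ineq: "f x \<ge> f y + t * (gradient f y \<bullet> G) + \<mu> / 2 * t\<^sup>2 * (G \<bullet> G)
      + c * (norm (d - (\<mu> * t) *\<^sub>R G))\<^sup>2"
    using smooth_strongly_convex_interpolation[OF smooth conv t, of y x]
    by (simp add: xy d_def c_def power_mult_distrib power2_norm_eq_inner[of G])
  \<comment> \<open>The weight \<open>c\<close> satisfies \<open>t = 2 c (1 - \<mu> t)\<close>, and with it the terms collect into a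
    square that no longer contains \<open>\<mu>\<close>.\<close>
  have square: "t * ((G - gradient f x) \<bullet> G) + t * (gradient f y \<bullet> G) + \<mu> / 2 * t\<^sup>2 * (G \<bullet> G)
      + c * (norm (d - (\<mu> * t) *\<^sub>R G))\<^sup>2 = t / 2 * (G \<bullet> G) + c * (norm (G - d))\<^sup>2"
  proof -
    define m where "m = \<mu> * t"
    have "1 - m > 0"
      using t by (simp add: m_def)
    then have m: "t = 2 * c * (1 - m)"
      unfolding c_def m_def[symmetric] by (simp add: field_simps)
    have "t * ((G - gradient f x) \<bullet> G) + t * (gradient f y \<bullet> G)
        = t * (G \<bullet> G) - t * (d \<bullet> G)"
      by (simp add: d_def algebra_simps)
    moreover have "\<mu> / 2 * t\<^sup>2 * (G \<bullet> G) = t * m / 2 * (G \<bullet> G)"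
      by (simp add: m_def power2_eq_square)
    moreover have "(norm (d - m *\<^sub>R G))\<^sup>2 = d \<bullet> d - 2 * m * (d \<bullet> G) + m\<^sup>2 * (G \<bullet> G)"
      unfolding power2_norm_eq_inner
      by (simp add: algebra_simps inner_commute power2_eq_square)
    moreover have "(norm (G - d))\<^sup>2 = d \<bullet> d - 2 * (d \<bullet> G) + G \<bullet> G"
      unfolding power2_norm_eq_inner by (simp add: algebra_simps inner_commute)
    moreover have "t * (G \<bullet> G) - t * (d \<bullet> G) + t * m / 2 * (G \<bullet> G)
        + c * (d \<bullet> d - 2 * m * (d \<bullet> G) + m\<^sup>2 * (G \<bullet> G))
        = t / 2 * (G \<bullet> G) + c * (d \<bullet> d - 2 * (d \<bullet> G) + G \<bullet> G)"
      unfolding m by (simp add: field_simps power2_eq_square)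
    ultimately show ?thesis
      unfolding m_def[symmetric] by (simp only:)
  qed
  have "norm (prox_gradient f g t y) \<le> norm (G - d)"
    using norm_prox_gradient_step_le[OF g t(1), of f x] by (simp add: y_def G_def d_def)
  then have "c * (norm (prox_gradient f g t y))\<^sup>2 \<le> c * (norm (G - d))\<^sup>2"
    using \<open>c > 0\<close> by (intro mult_left_mono power_mono) auto
  then have "f x + s \<ge> f y + r + t / 2 * (norm G)\<^sup>2 + c * (norm (prox_gradient f g t y))\<^sup>2"
    using f_ineq g_ineq square by (simp add: power2_norm_eq_inner)
  then show ?thesis
    by (simp add: composite_def s r G_def c_def)
qed

lemma prox_zero:
  assumes "t > 0"
  shows "prox t (\<lambda>_. 0) z = z"
proof -
  have "is_arg_min (\<lambda>u. ereal t * 0 + ereal (1 / 2 * (norm (u - z))\<^sup>2)) (\<lambda>_. True) = (\<lambda>u. u = z)"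
    unfolding is_arg_min_def by (auto simp: fun_eq_iff dest: spec[of _ z])
  then show ?thesis
    unfolding prox_def arg_min_def by (simp only: some_eq_trivial)
qed

lemma proper_closed_convex_zero:
  "proper_fun (\<lambda>_::'a::euclidean_space. 0)" "closed_fun (\<lambda>_::'a. 0)" "convex_fun (\<lambda>_::'a. 0)"
proof -
  have "ereal_epigraph (\<lambda>_::'a. 0) = UNIV \<times> {0..}"
    by (auto simp: ereal_epigraph_def)
  then show "closed_fun (\<lambda>_::'a. 0)" "convex_fun (\<lambda>_::'a. 0)"
    by (simp_all add: closed_fun_def convex_fun_def closed_Times convex_Times)
qed (simp add: proper_fun_def)

theorem lemma3p1:
  shows "(\<forall>(\<mu>::real) (L::real) (f :: 'a::euclidean_space \<Rightarrow> real) (g :: 'a \<Rightarrow> ereal).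
            0 < \<mu> \<and> \<mu> < L \<and> L_smooth L f \<and> strongly_convex \<mu> f \<and>
            proper_fun g \<and> closed_fun g \<and> convex_fun g \<longrightarrow>
            (\<forall>x t. 0 < t \<and> t \<le> 1 / L \<longrightarrow>
               composite f g x \<ge> composite f g (prox_grad_step f g t x)
                 + ereal (t / 2 * (norm (prox_gradient f g t x))\<^sup>2)
                 + ereal (t / (2 * (1 - \<mu> * t))
                     * (norm (prox_gradient f g t (prox_grad_step f g t x)))\<^sup>2))) \<and>
         (\<forall>(L::real) (f :: 'a \<Rightarrow> real) (g :: 'a \<Rightarrow> ereal).
            0 < L \<and> L_smooth L f \<and> convex_on UNIV f \<and>
            proper_fun g \<and> closed_fun g \<and> convex_fun g \<longrightarrow>
            (\<forall>x t. 0 < t \<and> t \<le> 1 / L \<longrightarrow>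
               composite f g x \<ge> composite f g (prox_grad_step f g t x)
                 + ereal (t / 2 * (norm (prox_gradient f g t x))\<^sup>2)
                 + ereal (t / 2 * (norm (prox_gradient f g t (prox_grad_step f g t x)))\<^sup>2))) \<and>
         (\<forall>(L::real) (f :: 'a \<Rightarrow> real).
            0 < L \<and> L_smooth L f \<and> convex_on UNIV f \<longrightarrow>
            (\<forall>x t. 0 < t \<and> t \<le> 1 / L \<longrightarrow>
               prox_grad_step f (\<lambda>_. 0) t x = x - t *\<^sub>R gradient f x \<and>
               f x \<ge> f (x - t *\<^sub>R gradient f x)
                 + t / 2 * (norm (gradient f x))\<^sup>2
                 + t / 2 * (norm (gradient f (x - t *\<^sub>R gradient f x)))\<^sup>2))"
proof (intro conjI allI impI; elim conjE)
  fix \<mu> L t :: real and f :: "'a \<Rightarrow> real" and g :: "'a \<Rightarrow> ereal" and x :: 'a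
  assume L: "0 < \<mu>" "\<mu> < L" and t: "0 < t" "t \<le> 1 / L"
    and fg: "L_smooth L f" "strongly_convex \<mu> f" "proper_fun g" "closed_fun g" "convex_fun g"
  have "t * L \<le> 1"
    using L t by (simp add: field_simps)
  moreover have "\<mu> * t < t * L"
    using L t by (simp add: mult.commute)
  ultimately show "composite f g x \<ge> composite f g (prox_grad_step f g t x)
                 + ereal (t / 2 * (norm (prox_gradient f g t x))\<^sup>2)
                 + ereal (t / (2 * (1 - \<mu> * t))
                     * (norm (prox_gradient f g t (prox_grad_step f g t x)))\<^sup>2)"
    using prox_grad_step_decrease[OF fg t(1)] by (meson order_less_le_trans)
next
  fix L t :: real and f :: "'a \<Rightarrow> real" and g :: "'a \<Rightarrow> ereal" and x :: 'a
  assume "0 < L" "0 < t" "t \<le> 1 / L" "L_smooth L f" "convex_on UNIV f"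
    "proper_fun g" "closed_fun g" "convex_fun g"
  then show "composite f g x \<ge> composite f g (prox_grad_step f g t x)
                 + ereal (t / 2 * (norm (prox_gradient f g t x))\<^sup>2)
                 + ereal (t / 2 * (norm (prox_gradient f g t (prox_grad_step f g t x)))\<^sup>2)"
    using prox_grad_step_decrease[of L f 0 g t x]
    by (simp add: strongly_convex_def field_simps)
next
  fix L t :: real and f :: "'a \<Rightarrow> real" and x :: 'a
  assume "0 < t"
  then show "prox_grad_step f (\<lambda>_. 0) t x = x - t *\<^sub>R gradient f x"
    by (simp add: prox_grad_step_def prox_zero)
next
  fix L t :: real and f :: "'a \<Rightarrow> real" and x :: 'a
  assume L: "0 < L" "L_smooth L f" "convex_on UNIV f" and t: "0 < t" "t \<le> 1 / L"
  have "prox_grad_step f (\<lambda>_. 0) t x = x - t *\<^sub>R gradient f x"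
    and "prox_gradient f (\<lambda>_. 0) t u = gradient f u" for u
    using t by (simp_all add: prox_grad_step_def prox_gradient_def prox_zero)
  moreover have "t * L \<le> 1"
    using L t by (simp add: field_simps)
  ultimately show "f x \<ge> f (x - t *\<^sub>R gradient f x)
                 + t / 2 * (norm (gradient f x))\<^sup>2
                 + t / 2 * (norm (gradient f (x - t *\<^sub>R gradient f x)))\<^sup>2"
    using prox_grad_step_decrease[of L f 0 "\<lambda>_. 0" t x] L t proper_closed_convex_zero
    by (simp add: strongly_convex_def composite_def)
qed

end
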